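(* Let $T: X \rightrightarrows X^*$ be a set-valued mapping. Then the following identity holds: $$\operatorname{ares}_{T}^{\phi} = \operatorname{Id} - \nabla \phi^* \circ \operatorname{bres}_{T^{-1}}^{\phi^*} \circ \nabla \phi .$$ If, furthermore, $T$ is monotone, then $\operatorname{ares}_T^\phi$ is single-valued.
   Context: $X$ is a Euclidean space, $X^*=X$ its dual, with the Euclidean inner product $\langle\cdot,\cdot\rangle$ as dual pairing. The prox-function $\phi: X \to \mathbb{R}$ is strictly convex, smooth and super-coercive ($\phi(x)/\|x\| \to \infty$ as $\|x\|\to\infty$), with $\nabla\phi(0)=0$; its convex conjugate $\phi^*:X^*\to\mathbb{R}$ has the same properties and $\nabla\phi:X\to X^*$ is a bijection with inverse $\nabla\phi^*$. For a set-valued mapping $T:X\rightrightarrows X^*$, its inverse is $T^{-1}: X^* \rightrightarrows X$, $T^{-1}(x^* )=\{x\in X: x^*\in T(x)\}$, and $T$ is monotone if $\langle x-y,x^*-y^*\rangle\ge 0$ for all $(x,x^* ),(y,y^* )$ in its graph. Sums and compositions of set-valued mappings are understood in the usual set-valued sense, and $\operatorname{Id}$ is the identity. Anisotropic resolvent of $T:X\rightrightarrows X^*$: $\operatorname{ares}_T^\phi:=(\operatorname{Id}+\nabla\phi^*\circ T)^{-1}: X\rightrightarrows X$. Bregman resolvent of $S:X^*\rightrightarrows X$: $\operatorname{bres}_S^{\phi^*}:=(\nabla\phi^*+S)^{-1}\circ\nabla\phi^*: X^*\rightrightarrows X^*$. *)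

theory Defs
  imports "HOL-Analysis.Analysis"
begin

text \<open>
  A set-valued mapping is a function into sets. The dual of a Euclidean space is identified with
  the space itself, so the prox-function, its conjugate and their gradients all live on one type.
\<close>

definition single :: "('a \<Rightarrow> 'b) \<Rightarrow> 'a \<Rightarrow> 'b set"
  where "single f = (\<lambda>x. {f x})"

definition svm_inverse :: "('a \<Rightarrow> 'b set) \<Rightarrow> 'b \<Rightarrow> 'a set"
  where "svm_inverse T = (\<lambda>y. {x. y \<in> T x})"

definition svm_comp :: "('b \<Rightarrow> 'c set) \<Rightarrow> ('a \<Rightarrow> 'b set) \<Rightarrow> 'a \<Rightarrow> 'c set"
    (infixl \<open>\<circ>\<^sub>s\<close> 75)
  where "S \<circ>\<^sub>s T = (\<lambda>x. \<Union>y\<in>T x. S y)"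

text \<open>
  Sum and difference are the pointwise Minkowski ones; in particular, the difference is unrelated
  to the set difference that \<open>-\<close> denotes on sets.
\<close>

definition svm_add :: "('a \<Rightarrow> 'b::plus set) \<Rightarrow> ('a \<Rightarrow> 'b set) \<Rightarrow> 'a \<Rightarrow> 'b set"
    (infixl \<open>+\<^sub>s\<close> 65)
  where "S +\<^sub>s T = (\<lambda>x. {u + v | u v. u \<in> S x \<and> v \<in> T x})"

definition svm_diff :: "('a \<Rightarrow> 'b::minus set) \<Rightarrow> ('a \<Rightarrow> 'b set) \<Rightarrow> 'a \<Rightarrow> 'b set"
    (infixl \<open>-\<^sub>s\<close> 65)
  where "S -\<^sub>s T = (\<lambda>x. {u - v | u v. u \<in> S x \<and> v \<in> T x})"

definition svm_monotone :: "('a::real_inner \<Rightarrow> 'a set) \<Rightarrow> bool"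
  where "svm_monotone T \<longleftrightarrow>
    (\<forall>x y. \<forall>x'\<in>T x. \<forall>y'\<in>T y. (x - y) \<bullet> (x' - y') \<ge> 0)"

text \<open>Values of a single-valued mapping may be empty: its domain need not be the whole space.\<close>

definition svm_single_valued :: "('a \<Rightarrow> 'b set) \<Rightarrow> bool"
  where "svm_single_valued T \<longleftrightarrow> (\<forall>x. \<exists>\<^sub>\<le>\<^sub>1y. y \<in> T x)"

definition gradient :: "('a::real_inner \<Rightarrow> real) \<Rightarrow> 'a \<Rightarrow> 'a"
  where "gradient f x = (THE D. GDERIV f x :> D)"

text \<open>
  The supremum is taken in the reals. This is the convex conjugate whenever the latter is finite
  everywhere, as is the case for super-coercive convex functions.
\<close>

definition conjugate :: "('a::real_inner \<Rightarrow> real) \<Rightarrow> 'a \<Rightarrow> real"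
  where "conjugate f y = (SUP x. x \<bullet> y - f x)"

definition strictly_convex :: "('a::real_vector \<Rightarrow> real) \<Rightarrow> bool"
  where "strictly_convex f \<longleftrightarrow>
    (\<forall>x y t. x \<noteq> y \<longrightarrow> 0 < t \<longrightarrow> t < 1 \<longrightarrow>
      f ((1 - t) *\<^sub>R x + t *\<^sub>R y) < (1 - t) * f x + t * f y)"

definition super_coercive :: "('a::real_normed_vector \<Rightarrow> real) \<Rightarrow> bool"
  where "super_coercive f \<longleftrightarrow> filterlim (\<lambda>x. f x / norm x) at_top at_infinity"

text \<open>
  Smoothness of a finite convex function means differentiability everywhere; on a Euclidean space
  the gradient is then automatically continuous.
\<close>

definition prox_function :: "('a::euclidean_space \<Rightarrow> real) \<Rightarrow> bool"
  where "prox_function \<phi> \<longleftrightarrow>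
    strictly_convex \<phi> \<and> (\<forall>x. \<phi> differentiable (at x)) \<and> super_coercive \<phi> \<and> gradient \<phi> 0 = 0"

definition ares :: "('a::euclidean_space \<Rightarrow> real) \<Rightarrow> ('a \<Rightarrow> 'a set) \<Rightarrow> 'a \<Rightarrow> 'a set"
  where "ares \<phi> T = svm_inverse (single id +\<^sub>s (single (gradient (conjugate \<phi>)) \<circ>\<^sub>s T))"

text \<open>
  The first argument of \<open>bres\<close> is the function whose gradient appears in the resolvent; the
  Bregman resolvent with respect to the conjugate is \<open>bres (conjugate \<phi>) S\<close>.
\<close>

definition bres :: "('a::euclidean_space \<Rightarrow> real) \<Rightarrow> ('a \<Rightarrow> 'a set) \<Rightarrow> 'a \<Rightarrow> 'a set"
  where "bres \<psi> S = svm_inverse (single (gradient \<psi>) +\<^sub>s S) \<circ>\<^sub>s single (gradient \<psi>)"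

end

theory Submission
  imports Defs
begin

text \<open>
  The identity is a rearrangement of \<open>x = u + \<nabla>\<phi>\<^sup>*(v)\<close>, \<open>v \<in> T(u)\<close>, in which the only analytic input is
  \<open>\<nabla>\<phi>\<^sup>*(\<nabla>\<phi>(x)) = x\<close>. If two such decompositions \<open>(u, v)\<close>, \<open>(u', v')\<close> of the same \<open>x\<close> are given, then
  \<open>u - u' = \<nabla>\<phi>\<^sup>*(v') - \<nabla>\<phi>\<^sup>*(v)\<close>, so monotonicity of \<open>T\<close> contradicts strict monotonicity of \<open>\<nabla>\<phi>\<^sup>*\<close>
  unless \<open>v = v'\<close>.

  To differentiate \<open>\<phi>\<^sup>*\<close> at \<open>y = \<nabla>\<phi>(x)\<close>: since \<open>x\<close> is the strict minimiser of \<open>\<phi> - \<langle>\<cdot>, y\<rangle>\<close>, the remainder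
  \<open>\<phi>\<^sup>*(\<nabla>\<phi>(w)) - \<phi>\<^sup>*(y) - \<langle>x, \<nabla>\<phi>(w) - y\<rangle>\<close> lies between \<open>0\<close> and \<open>\<langle>w - x, \<nabla>\<phi>(w) - y\<rangle>\<close>. It remains to see
  that \<open>\<nabla>\<phi>\<close> is onto (coercivity) with continuous inverse (compactness of spheres and convexity).
\<close>

lemma gradient_eqI:
  assumes "GDERIV f x :> D"
  shows "gradient f x = D"
  unfolding gradient_def
proof (rule the_equality)
  fix E assume "GDERIV f x :> E"
  then have "(\<lambda>h. h \<bullet> E) = (\<lambda>h. h \<bullet> D)"
    using assms unfolding gderiv_def by (rule has_derivative_unique)
  then show "E = D"
    by (metis vector_eq_ldot)
qed (fact assms)

text \<open>The vector that represents the derivative has the values of the derivative on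
  \<open>Basis\<close> as coordinates, so the description in \<open>gradient\<close>
  denotes.\<close>

lemma GDERIV_gradient:
  fixes f :: "'a::euclidean_space \<Rightarrow> real"
  assumes "f differentiable (at x)"
  shows "GDERIV f x :> gradient f x"
proof -
  obtain f' where f': "(f has_derivative f') (at x)"
    using assms by (auto simp: differentiable_def)
  then interpret bounded_linear f' by (rule has_derivative_bounded_linear)
  have "f' h = h \<bullet> (\<Sum>i\<in>Basis. f' i *\<^sub>R i)" for h
  proof -
    have "f' h = f' (\<Sum>i\<in>Basis. (h \<bullet> i) *\<^sub>R i)"
      by (simp add: euclidean_representation)
    also have "\<dots> = h \<bullet> (\<Sum>i\<in>Basis. f' i *\<^sub>R i)"
      by (simp add: sum scale inner_sum_right mult.commute)
    finally show ?thesis .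
  qed
  then have "f' = (\<lambda>h. h \<bullet> (\<Sum>i\<in>Basis. f' i *\<^sub>R i))" by (rule ext)
  then have "GDERIV f x :> (\<Sum>i\<in>Basis. f' i *\<^sub>R i)"
    using f' by (metis gderiv_def)
  then show ?thesis
    using gradient_eqI by metis
qed

text \<open>Restricting \<open>f\<close> to the line through \<open>a\<close> and \<open>b\<close>
  reduces this to the tangent bound for convex functions of one real variable.\<close>

lemma convex_on_gradient_le:
  fixes f :: "'a::euclidean_space \<Rightarrow> real"
  assumes "convex_on UNIV f" "f differentiable (at a)"
  shows "f a + (b - a) \<bullet> gradient f a \<le> f b"
proof -
  define k where "k = (\<lambda>t. f (a + t *\<^sub>R (b - a)))"
  have "convex_on UNIV k"
  proof (rule convex_onI)
    fix t x y :: real assume "0 < t" "t < 1"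
    moreover have "a + ((1 - t) * x + t * y) *\<^sub>R (b - a)
        = (1 - t) *\<^sub>R (a + x *\<^sub>R (b - a)) + t *\<^sub>R (a + y *\<^sub>R (b - a))"
      by (simp add: algebra_simps)
    ultimately show "k ((1 - t) *\<^sub>R x + t *\<^sub>R y) \<le> (1 - t) * k x + t * k y"
      unfolding k_def using convex_onD[OF assms(1), of t] by auto
  qed simp
  moreover have "(k has_real_derivative (b - a) \<bullet> gradient f a) (at 0)"
  proof -
    have "(f has_derivative (\<lambda>h. h \<bullet> gradient f a)) (at (a + 0 *\<^sub>R (b - a)))"
      using GDERIV_gradient[OF assms(2)] by (simp add: gderiv_def)
    moreover have "((\<lambda>t. a + t *\<^sub>R (b - a)) has_derivative (\<lambda>t. t *\<^sub>R (b - a))) (at 0)"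
      by (auto intro!: derivative_eq_intros)
    ultimately have "(k has_derivative (\<lambda>t. (t *\<^sub>R (b - a)) \<bullet> gradient f a)) (at 0)"
      unfolding k_def by (rule has_derivative_compose[rotated])
    then show ?thesis
      by (simp add: has_field_derivative_def mult_commute_abs)
  qed
  ultimately have "k 1 - k 0 \<ge> ((b - a) \<bullet> gradient f a) * (1 - 0)"
    by (intro convex_on_imp_above_tangent[where A = UNIV]) auto
  then show ?thesis
    by (simp add: k_def)
qed

lemma strictly_convex_imp_convex_on:
  assumes "strictly_convex f"
  shows "convex_on UNIV f"
proof (rule convex_onI)
  fix t x y assume t: "0 < (t::real)" "t < 1"
  show "f ((1 - t) *\<^sub>R x + t *\<^sub>R y) \<le> (1 - t) * f x + t * f y"
  proof (cases "x = y")
    case True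
    have "(1 - t) *\<^sub>R y + t *\<^sub>R y = y" by (simp add: algebra_simps)
    then show ?thesis using True by (simp add: algebra_simps)
  next
    case False
    then show ?thesis
      using assms t by (auto simp: strictly_convex_def intro: less_imp_le)
  qed
qed simp

locale smooth_strictly_convex =
  fixes f :: "'a::euclidean_space \<Rightarrow> real"
  assumes strictly_convex: "strictly_convex f"
    and differentiable: "f differentiable (at x)"
begin

text \<open>The weak tangent bound is applied at the midpoint \<open>m\<close>, where strict
  convexity puts \<open>f\<close> strictly below the average of \<open>f a\<close> and
  \<open>f b\<close>.\<close>

lemma gradient_less:
  assumes "a \<noteq> b"
  shows "f a + (b - a) \<bullet> gradient f a < f b"
proof -
  define m where "m = (1 - 1/2) *\<^sub>R a + (1/2::real) *\<^sub>R b"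
  have "m - a = (1/2::real) *\<^sub>R (b - a)"
    unfolding m_def by (simp add: algebra_simps flip: scaleR_left_distrib)
  then have "f a + ((b - a) \<bullet> gradient f a) / 2 \<le> f m"
    using convex_on_gradient_le[OF strictly_convex_imp_convex_on[OF strictly_convex] differentiable, of a m]
    by simp
  also have "f m < (1 - 1/2) * f a + 1/2 * f b"
    unfolding m_def using strictly_convex assms unfolding strictly_convex_def
    by (elim allE[of _ a] allE[of _ b] allE[of _ "1/2::real"]) simp
  finally show ?thesis by simp
qed

lemma gradient_le: "f a + (b - a) \<bullet> gradient f a \<le> f b"
  using gradient_less[of a b] by (cases "a = b") auto

lemma gradient_strict_mono:
  assumes "a \<noteq> b"
  shows "0 < (a - b) \<bullet> (gradient f a - gradient f b)"
  using gradient_less[OF assms] gradient_less[OF assms[symmetric]]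
  by (simp add: algebra_simps)

text \<open>By the tangent inequality at \<open>x\<close> the supremum is attained there.\<close>

lemma conjugate_gradient: "conjugate f (gradient f x) = x \<bullet> gradient f x - f x"
  unfolding conjugate_def
proof (rule cSup_eq_maximum)
  fix r assume "r \<in> range (\<lambda>u. u \<bullet> gradient f x - f u)"
  then obtain u where "r = u \<bullet> gradient f x - f u" by blast
  then show "r \<le> x \<bullet> gradient f x - f x"
    using gradient_le[of x u] by (simp add: algebra_simps)
qed blast

text \<open>Contrapositive: tilting \<open>f\<close> by its gradient at \<open>x\<close> gives
  \<open>F\<close> with strict minimiser \<open>x\<close>. The gap of \<open>F\<close> on the sphere
  of radius \<open>e\<close> propagates outwards by convexity and keeps the gradients at least
  \<open>\<delta> / e\<close> apart.\<close>

lemma gradient_inverse_continuous: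
  assumes "0 < e"
  shows "\<exists>d>0. \<forall>z. norm (gradient f z - gradient f x) < d \<longrightarrow> norm (z - x) < e"
proof -
  define F where "F u = f u - u \<bullet> gradient f x" for u
  have "continuous_on UNIV f"
    using differentiable differentiable_imp_continuous_within continuous_at_imp_continuous_on by blast
  then have "continuous_on (sphere x e) F"
    unfolding F_def by (intro continuous_intros) (auto intro: continuous_on_subset)
  moreover have "sphere x e \<noteq> {}"
    using assms by simp
  ultimately obtain s where s: "s \<in> sphere x e" and min: "\<And>u. u \<in> sphere x e \<Longrightarrow> F s \<le> F u"
    using continuous_attains_inf[OF compact_sphere] by metis
  define \<delta> where "\<delta> = F s - F x"
  have "x \<noteq> s" using s assms by auto
  then have "0 < \<delta>"
    using gradient_less[of x s] by (simp add: \<delta>_def F_def algebra_simps)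
  have "\<delta> / e \<le> norm (gradient f z - gradient f x)" if z: "e \<le> norm (z - x)" for z
  proof -
    \<comment> \<open>With this \<open>t\<close>, the point \<open>u\<close> below is where the
      segment from \<open>x\<close> to \<open>z\<close> meets the sphere.\<close>
    define t where "t = e / norm (z - x)"
    have pos: "0 < norm (z - x)" using z assms by linarith
    have t: "0 < t" "t \<le> 1" using z assms pos by (auto simp: t_def)
    define u where "u = (1 - t) *\<^sub>R x + t *\<^sub>R z"
    have "u - x = t *\<^sub>R (z - x)" by (simp add: u_def algebra_simps)
    then have "norm (u - x) = e" using assms t pos by (simp add: t_def)
    then have "u \<in> sphere x e" by (simp add: dist_norm norm_minus_commute)
    then have "F s \<le> F u" by (rule min)
    also have "F u \<le> (1 - t) * F x + t * F z"
    proof -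
      have "f u \<le> (1 - t) * f x + t * f z"
        unfolding u_def using convex_onD[OF strictly_convex_imp_convex_on[OF strictly_convex]] t by simp
      then show ?thesis by (simp add: F_def u_def algebra_simps)
    qed
    finally have "\<delta> \<le> t * (F z - F x)"
      by (simp add: \<delta>_def algebra_simps)
    also have "\<dots> \<le> t * ((z - x) \<bullet> (gradient f z - gradient f x))"
      using gradient_le[of z x] t by (intro mult_left_mono) (auto simp: F_def algebra_simps)
    also have "\<dots> \<le> t * (norm (z - x) * norm (gradient f z - gradient f x))"
      using t by (intro mult_left_mono norm_cauchy_schwarz) auto
    also have "\<dots> = e * norm (gradient f z - gradient f x)"
      using pos by (simp add: t_def)
    finally show ?thesis using assms by (simp add: field_simps)
  qed
  then show ?thesis
    using \<open>0 < \<delta>\<close> assms by (meson divide_pos_pos not_less)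
qed

text \<open>Coercivity yields a global minimiser of \<open>f\<close> minus the linear form of
  \<open>y\<close>; the derivative vanishes there.\<close>

lemma gradient_surj:
  assumes "super_coercive f"
  shows "\<exists>x. gradient f x = y"
proof -
  define F where "F u = f u - u \<bullet> y" for u
  have cont: "continuous_on S f" for S
    using differentiable differentiable_imp_continuous_within continuous_at_imp_continuous_on by blast
  \<comment> \<open>In this threshold \<open>norm y\<close> absorbs the linear term, and
    \<open>\<bar>f 0\<bar>\<close> leaves enough to exceed \<open>F 0\<close> once
    \<open>norm u\<close> is at least 1.\<close>
  have "\<forall>\<^sub>F u in at_infinity. norm y + \<bar>f 0\<bar> \<le> f u / norm u"
    using assms unfolding super_coercive_def filterlim_at_top by blast
  then obtain R where R: "\<And>u. R \<le> norm u \<Longrightarrow> norm y + \<bar>f 0\<bar> \<le> f u / norm u"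
    unfolding eventually_at_infinity by blast
  define r where "r = max R 1"
  have outside: "F 0 \<le> F u" if u: "r \<le> norm u" for u
  proof -
    have n: "1 \<le> norm u" "R \<le> norm u" using u by (auto simp: r_def)
    have "(norm y + \<bar>f 0\<bar>) * norm u \<le> f u"
      using R[OF n(2)] n(1) by (subst (asm) pos_le_divide_eq) linarith+
    moreover have "u \<bullet> y \<le> norm u * norm y" by (rule norm_cauchy_schwarz)
    moreover have "\<bar>f 0\<bar> * 1 \<le> \<bar>f 0\<bar> * norm u" using n(1) by (intro mult_left_mono) auto
    ultimately show ?thesis by (simp add: F_def algebra_simps)
  qed
  have "continuous_on (cball 0 r) F"
    unfolding F_def by (intro continuous_intros cont)
  moreover have zero: "(0::'a) \<in> cball 0 r" by (simp add: r_def)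
  ultimately obtain x where x: "\<And>u. u \<in> cball 0 r \<Longrightarrow> F x \<le> F u"
    using continuous_attains_inf[OF compact_cball] by (metis empty_iff)
  have "F x \<le> F u" for u
    using x[of u] x[OF zero] outside[of u] by (cases "norm u \<le> r") auto
  moreover have "(F has_derivative (\<lambda>h. h \<bullet> gradient f x - h \<bullet> y)) (at x)"
    unfolding F_def
    using GDERIV_gradient[OF differentiable] by (auto simp: gderiv_def intro!: derivative_eq_intros)
  ultimately have "(\<lambda>h. h \<bullet> gradient f x - h \<bullet> y) = (\<lambda>h. 0)"
    by (intro has_derivative_local_min) auto
  then have "\<forall>h. h \<bullet> gradient f x = h \<bullet> y"
    by (metis eq_iff_diff_eq_0)
  then show ?thesis by (metis vector_eq_ldot)
qed

lemma gradient_conjugate_gradient: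
  assumes "super_coercive f"
  shows "gradient (conjugate f) (gradient f x) = x"
proof (rule gradient_eqI)
  let ?y = "gradient f x"
  have "\<exists>d>0. \<forall>z. norm (z - ?y) < d \<longrightarrow>
      norm (conjugate f z - conjugate f ?y - (z - ?y) \<bullet> x) \<le> e * norm (z - ?y)" if "e > 0" for e
  proof -
    obtain d where "d > 0"
      and d: "\<And>w. norm (gradient f w - ?y) < d \<Longrightarrow> norm (w - x) < e"
      using gradient_inverse_continuous[OF \<open>e > 0\<close>] by blast
    have "norm (conjugate f z - conjugate f ?y - (z - ?y) \<bullet> x) \<le> e * norm (z - ?y)"
      if z: "norm (z - ?y) < d" for z
    proof -
      \<comment> \<open>Surjectivity makes the explicit value of the conjugate available at every
        \<open>z\<close> near \<open>?y\<close>.\<close>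
      obtain w where w: "gradient f w = z"
        using gradient_surj[OF assms] by blast
      let ?r = "conjugate f z - conjugate f ?y - (z - ?y) \<bullet> x"
      have r: "?r = w \<bullet> z - f w - (x \<bullet> ?y - f x) - (z - ?y) \<bullet> x"
        using conjugate_gradient[of w] conjugate_gradient[of x] by (simp add: w)
      \<comment> \<open>The lower bound is the tangent inequality at \<open>w\<close> evaluated at
        \<open>x\<close>; the upper bound exchanges the two points.\<close>
      have "0 \<le> ?r"
        using gradient_le[of w x] unfolding r by (simp add: w algebra_simps inner_commute)
      moreover have "?r \<le> (w - x) \<bullet> (z - ?y)"
        using gradient_le[of x w] unfolding r by (simp add: algebra_simps inner_commute)
      moreover have "(w - x) \<bullet> (z - ?y) \<le> norm (w - x) * norm (z - ?y)"
        by (rule norm_cauchy_schwarz)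
      moreover have "norm (w - x) * norm (z - ?y) \<le> e * norm (z - ?y)"
        using d[of w] z by (intro mult_right_mono) (auto simp: w)
      ultimately show ?thesis by simp
    qed
    with \<open>d > 0\<close> show ?thesis by blast
  qed
  then show "GDERIV (conjugate f) ?y :> x"
    unfolding gderiv_def has_derivative_at_alt by (auto intro: bounded_linear_inner_left)
qed

end

theorem proposition3p5:
  fixes \<phi> :: "'a::euclidean_space \<Rightarrow> real" and T :: "'a \<Rightarrow> 'a set"
  assumes "prox_function \<phi>"
  shows "ares \<phi> T =
      single id -\<^sub>s
        (single (gradient (conjugate \<phi>)) \<circ>\<^sub>s bres (conjugate \<phi>) (svm_inverse T) \<circ>\<^sub>s single (gradient \<phi>))
    \<and> (svm_monotone T \<longrightarrow> svm_single_valued (ares \<phi> T))"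
proof -
  interpret smooth_strictly_convex \<phi>
    using assms by unfold_locales (auto simp: prox_function_def)
  have coercive: "super_coercive \<phi>"
    using assms by (simp add: prox_function_def)
  let ?g = "gradient (conjugate \<phi>)"
  have inv: "?g (gradient \<phi> x) = x" for x
    by (rule gradient_conjugate_gradient[OF coercive])
  have ares: "u \<in> ares \<phi> T x \<longleftrightarrow> (\<exists>v\<in>T u. x = u + ?g v)" for u x
    by (auto simp: ares_def svm_inverse_def svm_add_def svm_comp_def single_def)
  \<comment> \<open>By \<open>inv\<close>, membership means that \<open>x\<close> is
    \<open>?g v\<close> plus some \<open>u\<close> with \<open>v\<close> in \<open>T u\<close>,
    which determines \<open>u\<close>.\<close>
  have bres: "v \<in> bres (conjugate \<phi>) (svm_inverse T) (gradient \<phi> x)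
      \<longleftrightarrow> v \<in> T (x - ?g v)" for v x
    by (force simp: bres_def svm_inverse_def svm_add_def svm_comp_def single_def inv)
  have identity: "ares \<phi> T = single id -\<^sub>s
      (single ?g \<circ>\<^sub>s bres (conjugate \<phi>) (svm_inverse T) \<circ>\<^sub>s single (gradient \<phi>))" (is "_ = ?rhs")
  proof (intro ext set_eqI)
    fix x u
    have "u \<in> ?rhs x \<longleftrightarrow>
        (\<exists>v. v \<in> bres (conjugate \<phi>) (svm_inverse T) (gradient \<phi> x) \<and> u = x - ?g v)"
      by (auto simp: svm_diff_def svm_comp_def single_def)
    then have "u \<in> ?rhs x \<longleftrightarrow> (\<exists>v. v \<in> T (x - ?g v) \<and> u = x - ?g v)"
      by (simp only: bres)
    then show "u \<in> ares \<phi> T x \<longleftrightarrow> u \<in> ?rhs x"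
      by (force simp: ares)
  qed
  have "svm_single_valued (ares \<phi> T)" if mono: "svm_monotone T"
    unfolding svm_single_valued_def
  proof (intro allI Uniq_I)
    fix x u u'
    assume "u \<in> ares \<phi> T x" "u' \<in> ares \<phi> T x"
    then obtain v v' where v: "v \<in> T u" "x = u + ?g v" and v': "v' \<in> T u'" "x = u' + ?g v'"
      by (auto simp: ares)
    \<comment> \<open>Passing to preimages replaces strict monotonicity of \<open>?g\<close> by that
      of \<open>gradient \<phi>\<close>, which is already proved.\<close>
    obtain a b where ab: "gradient \<phi> a = v" "gradient \<phi> b = v'"
      using gradient_surj[OF coercive] by metis
    have eq: "u + a = u' + b"
      using v(2) v'(2) inv[of a] inv[of b] by (simp add: ab)
    then have "u - u' = - (a - b)"
      by (simp add: algebra_simps)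
    moreover have "0 \<le> (u - u') \<bullet> (v - v')"
      using mono v(1) v'(1) by (auto simp: svm_monotone_def)
    ultimately have "(a - b) \<bullet> (gradient \<phi> a - gradient \<phi> b) \<le> 0"
      by (simp add: ab inner_diff_left)
    then have "a = b"
      using gradient_strict_mono[of a b] by force
    then show "u = u'"
      using eq by simp
  qed
  with identity show ?thesis by blast
qed

end
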